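(* Let $(X,M,Y)$ be a random element of $\mathbb{R}^d\times\{0,1\}^d\times\{-1,1\}$ such that $M$ is independent of $(X,Y)$, $\mathbb{P}(Y=1)=\mathbb{P}(Y=-1)$, and for each $k\in\{-1,1\}$, $X|Y=k\sim\mathcal{N}(\mu_k,\Sigma)$ with $\mu_k\in\mathbb{R}^d$ and $\Sigma$ a symmetric positive definite $d\times d$ matrix. Then for every pattern $m$ with $\mathbb{P}(M=m)>0$, the pattern-by-pattern Bayes classifier $h_m^\star(X_{\mathrm{obs}(m)})=\mathrm{sign}(\mathbb{E}[Y|X_{\mathrm{obs}(m)},M=m])$ is given by $$h^\star_m(x_{\mathrm{obs}(m)})=\mathrm{sign}\Big(\big(\mu_{1,\mathrm{obs}(m)}-\mu_{-1,\mathrm{obs}(m)}\big)^\top\Sigma_{\mathrm{obs}(m)}^{-1}\Big(x_{\mathrm{obs}(m)}-\frac{\mu_{1,\mathrm{obs}(m)}+\mu_{-1,\mathrm{obs}(m)}}{2}\Big)\Big).$$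
   Context: $M_j=1$ means that $X_j$ is missing; $\mathrm{obs}(m)=\{j:m_j=0\}$. For a vector $v\in\mathbb{R}^d$, $v_{\mathrm{obs}(m)}$ is its subvector indexed by $\mathrm{obs}(m)$; $\Sigma_{\mathrm{obs}(m)}$ is the submatrix of $\Sigma$ with rows and columns indexed by $\mathrm{obs}(m)$ and $\Sigma_{\mathrm{obs}(m)}^{-1}=(\Sigma_{\mathrm{obs}(m)})^{-1}$. Convention: $\mathrm{sign}(x)=1$ if $x\ge0$ and $-1$ otherwise. With $Z=(X_{\mathrm{obs}(M)},M)$, the Bayes predictor (minimizer of $\mathbb{P}(Y\ne h(Z))$) is $h^\star_{\mathrm{mis}}(Z)=\sum_m h^\star_m(X_{\mathrm{obs}(m)})\mathbf{1}_{M=m}$. An empty product or sum (when $\mathrm{obs}(m)=\emptyset$) is read as $0$ inside the sign. *)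

theory Defs
  imports "HOL-Probability.Probability"
begin

(* Unlike sgn, this takes the value 1 at 0. *)
definition sign_pm :: "real \<Rightarrow> real" where
  "sign_pm x = (if x \<ge> 0 then 1 else -1)"

(* A missingness pattern m in {0,1}^d is a vector of type bool ^ 'd; m $ j holds iff
   coordinate j is missing. *)
definition obs :: "bool ^ 'd \<Rightarrow> 'd set" where
  "obs m = {j. \<not> m $ j}"

(* Since the dimension of R^obs(m) depends on m, vectors and matrices indexed by obs(m) are
   functions on the set obs m, undefined outside it. *)
definition obs_space :: "bool ^ 'd \<Rightarrow> ('d \<Rightarrow> real) measure" where
  "obs_space m = (\<Pi>\<^sub>M j\<in>obs m. borel)"

definition subvec :: "bool ^ 'd \<Rightarrow> real ^ 'd \<Rightarrow> 'd \<Rightarrow> real" where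
  "subvec m v = (\<lambda>j\<in>obs m. v $ j)"

definition submat :: "bool ^ 'd \<Rightarrow> real ^ 'd ^ 'd \<Rightarrow> 'd \<Rightarrow> 'd \<Rightarrow> real" where
  "submat m A = (\<lambda>i\<in>obs m. \<lambda>j\<in>obs m. A $ i $ j)"

(* Two-sided inverse of a matrix with rows and columns indexed by the finite set I; the
   counterpart of matrix_inv. Only the entries with both indices in I are meaningful. *)
definition inverse_on :: "'d set \<Rightarrow> ('d \<Rightarrow> 'd \<Rightarrow> real) \<Rightarrow> 'd \<Rightarrow> 'd \<Rightarrow> real" where
  "inverse_on I A = (SOME B. \<forall>i\<in>I. \<forall>j\<in>I.
     (\<Sum>k\<in>I. A i k * B k j) = (if i = j then 1 else 0) \<and>
     (\<Sum>k\<in>I. B i k * A k j) = (if i = j then 1 else 0))"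

(* Intended for symmetric positive definite S only. *)
definition multivariate_normal :: "real ^ 'd \<Rightarrow> real ^ 'd ^ 'd \<Rightarrow> (real ^ 'd) measure" where
  "multivariate_normal \<mu> S = density lborel (\<lambda>x. ennreal
     (exp (- ((x - \<mu>) \<bullet> (matrix_inv S *v (x - \<mu>))) / 2) / sqrt ((2 * pi) ^ CARD('d) * det S)))"

(* g is a version of the function z \<mapsto> E[Y | U = z], where U takes values in N. *)
definition regression_function ::
    "'a measure \<Rightarrow> 'b measure \<Rightarrow> ('a \<Rightarrow> 'b) \<Rightarrow> ('a \<Rightarrow> real) \<Rightarrow> ('b \<Rightarrow> real) \<Rightarrow> bool" where
  "regression_function P N U Y g \<longleftrightarrow> g \<in> borel_measurable N \<and>
     (AE \<omega> in P. real_cond_exp P (vimage_algebra (space P) U N) Y \<omega> = g (U \<omega>))"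

(* The conditional probability P( . | M = m). *)
definition cond_pattern :: "'a measure \<Rightarrow> ('a \<Rightarrow> bool ^ 'd) \<Rightarrow> bool ^ 'd \<Rightarrow> 'a measure" where
  "cond_pattern P M m = uniform_measure P {\<omega> \<in> space P. M \<omega> = m}"

(* h(x) = sign(E[Y | X_obs(m) = x, M = m]) on R^obs(m). The conditional expectation is only
   determined up to null sets of the law of X_obs(m) given M = m, so this is a predicate
   satisfied by all the versions of the classifier. *)
definition pattern_bayes_classifier ::
    "'a measure \<Rightarrow> ('a \<Rightarrow> real ^ 'd) \<Rightarrow> ('a \<Rightarrow> bool ^ 'd) \<Rightarrow> ('a \<Rightarrow> real) \<Rightarrow> bool ^ 'd
      \<Rightarrow> (('d \<Rightarrow> real) \<Rightarrow> real) \<Rightarrow> bool" where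
  "pattern_bayes_classifier P X M Y m h \<longleftrightarrow>
     (\<exists>g. regression_function (cond_pattern P M m) (obs_space m) (\<lambda>\<omega>. subvec m (X \<omega>)) Y g \<and>
          (\<forall>x\<in>space (obs_space m). h x = sign_pm (g x)))"

(* u^T S_obs(m)^{-1} (x - (a + b)/2) with u = a_obs(m) - b_obs(m), under the sign. *)
definition lda_rule ::
    "real ^ 'd \<Rightarrow> real ^ 'd \<Rightarrow> real ^ 'd ^ 'd \<Rightarrow> bool ^ 'd \<Rightarrow> ('d \<Rightarrow> real) \<Rightarrow> real" where
  "lda_rule a b S m x = sign_pm
     (\<Sum>i\<in>obs m. (subvec m a i - subvec m b i) *
        (\<Sum>j\<in>obs m. inverse_on (obs m) (submat m S) i j * (x j - (subvec m a j + subvec m b j) / 2)))"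

end

theory Submission
  imports Defs
begin

text \<open>
  Independence of \<^term>\<open>M\<close> and \<^term>\<open>(X, Y)\<close> means that conditioning on a pattern leaves the joint
  law of \<^term>\<open>X\<close> and \<^term>\<open>Y\<close> unchanged, so only the two class-conditional laws of the observed
  subvector have to be compared. Their log-likelihood ratio turns out to be exactly the linear
  discriminant score \<open>L\<close>. Since the classes are balanced, the regression function is then
  \<open>(exp L - 1) / (exp L + 1) = tanh (L / 2)\<close>, which has the sign of \<open>L\<close>.
  Any other version of the conditional expectation agrees with this one almost surely, and so does
  the classifier derived from it.

  The likelihood ratio of the observed subvectors is found without computing any marginal density.
  Translating a normal vector in the unobserved directions does not affect its observed
  part. Hence, in comparing \<open>N(a, S)\<close> with \<open>N(b, S)\<close>, the mean \<open>a\<close> may be replaced by any mean with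
  the same observed coordinates. The right choice is \<open>b + S v\<close>, where \<open>v\<close> is supported on the observed
  coordinates and solves \<open>S_obs v_obs = a_obs - b_obs\<close>: by completing the square
  (the finite-dimensional Cameron--Martin formula), the density of \<open>N(b + S v, S)\<close> relative to
  \<open>N(b, S)\<close> at \<open>x\<close> is \<open>exp (v \<bullet> (x - b) - v \<bullet> S v / 2)\<close>. It depends on the observed coordinates of
  \<open>x\<close> alone and therefore survives the projection onto them. Substituting \<open>v\<close> shows that
  the exponent is the discriminant score (lemma \<open>observed_normal_likelihood_ratio\<close>).
\<close>

section \<open>Balanced binary regression from a likelihood ratio\<close>

lemma integral_uniform_measure:
  fixes f :: "'a \<Rightarrow> real"
  assumes "finite_measure M" and [measurable]: "A \<in> sets M" and "measure M A > 0"
    and [measurable]: "f \<in> borel_measurable M"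
  shows "(\<integral>x. f x \<partial>uniform_measure M A) = (\<integral>x. indicator A x * f x \<partial>M) / measure M A"
proof -
  interpret finite_measure M by fact
  have "uniform_measure M A = density M (\<lambda>x. ennreal (indicator A x / measure M A))"
    unfolding uniform_measure_def using assms(3)
    by (intro arg_cong[where f = "density M"] ext)
       (auto simp: emeasure_eq_measure divide_ennreal simp flip: ennreal_indicator split: split_indicator)
  thus ?thesis
    using assms(3) by (simp add: integral_density)
qed

text \<open>
  Bayes' formula with prior odds one: the posterior odds are \<^term>\<open>exp (L x)\<close>, and a variable with
  values \<open>\<plusminus>1\<close> and odds \<open>r\<close> has mean \<open>(r - 1) / (r + 1)\<close>.
\<close>

lemma regression_function_exp_likelihood_ratio:
  fixes R :: "'a measure" and Y :: "'a \<Rightarrow> real" and L :: "'b \<Rightarrow> real"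
  assumes "prob_space R"
    and U [measurable]: "U \<in> measurable R N"
    and Y [measurable]: "Y \<in> borel_measurable R"
    and Y_vals: "\<And>\<omega>. \<omega> \<in> space R \<Longrightarrow> Y \<omega> \<in> {-1, 1}"
    and balanced: "measure R {\<omega> \<in> space R. Y \<omega> = 1} = measure R {\<omega> \<in> space R. Y \<omega> = -1}"
    and L [measurable]: "L \<in> borel_measurable N"
    and ratio: "distr (uniform_measure R {\<omega> \<in> space R. Y \<omega> = 1}) N U =
      density (distr (uniform_measure R {\<omega> \<in> space R. Y \<omega> = -1}) N U) (\<lambda>x. ennreal (exp (L x)))"
  shows "regression_function R N U Y (\<lambda>x. (exp (L x) - 1) / (exp (L x) + 1))"
proof -
  interpret prob_space R by fact
  let ?g = "\<lambda>x. (exp (L x) - 1) / (exp (L x) + 1)"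
  let ?C = "\<lambda>k. {\<omega> \<in> space R. Y \<omega> = k}"
  have C [measurable]: "?C k \<in> sets R" for k by measurable
  have "prob (?C 1) + prob (?C (-1)) = prob (?C 1 \<union> ?C (-1))"
    by (subst finite_measure_Union) auto
  also have "?C 1 \<union> ?C (-1) = space R" using Y_vals by auto
  finally have half: "prob (?C 1) = 1/2" "prob (?C (-1)) = 1/2"
    using balanced by (simp_all add: prob_space)
  define \<nu> where "\<nu> k = distr (uniform_measure R (?C k)) N U" for k
  have [measurable_cong, simp]: "sets (\<nu> k) = sets N" for k by (simp add: \<nu>_def)
  have prob_\<nu>: "prob_space (\<nu> k)" if "k \<in> {-1, 1}" for k
    unfolding \<nu>_def using that half
    by (intro prob_space.prob_space_distr prob_space_uniform_measure) (auto simp: emeasure_eq_measure)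
  have ratio: "\<nu> 1 = density (\<nu> (-1)) (\<lambda>x. ennreal (exp (L x)))"
    unfolding \<nu>_def using ratio by simp
  have g_bd: "\<bar>?g x\<bar> \<le> 1" for x
  proof -
    have "\<bar>exp (L x) - 1\<bar> \<le> exp (L x) + 1" using exp_gt_zero[of "L x"] by linarith
    thus ?thesis by (simp add: abs_divide add_pos_pos)
  qed
  have int_\<nu>: "integrable (\<nu> k) f" if "k \<in> {-1, 1}" "f \<in> borel_measurable N" "\<And>x. \<bar>f x\<bar> \<le> 1"
    for k and f :: "'b \<Rightarrow> real"
  proof -
    interpret \<nu>: prob_space "\<nu> k" using prob_\<nu> that by blast
    show ?thesis using that by (intro \<nu>.integrable_const_bound[of _ 1]) auto
  qed
  have class_part: "(\<integral>\<omega>. indicator (?C k) \<omega> * f (U \<omega>) \<partial>R) = (\<integral>x. f x \<partial>\<nu> k) / 2"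
    if "k \<in> {-1, 1}" and [measurable]: "f \<in> borel_measurable N" for k and f :: "'b \<Rightarrow> real"
  proof -
    have "(\<integral>x. f x \<partial>\<nu> k) = (\<integral>\<omega>. f (U \<omega>) \<partial>uniform_measure R (?C k))"
      unfolding \<nu>_def by (subst integral_distr) auto
    also have "\<dots> = (\<integral>\<omega>. indicator (?C k) \<omega> * f (U \<omega>) \<partial>R) / prob (?C k)"
      using that half by (intro integral_uniform_measure) (auto intro: finite_measure_axioms)
    finally show ?thesis using that half by auto
  qed
  \<comment> \<open>Both sides are written as integrals over the law of the negative class; there the claim is the
    pointwise identity \<open>e\<^sup>L - 1 = (e\<^sup>L + 1) g\<close>.\<close>
  have char: "(\<integral>\<omega>. f (U \<omega>) * Y \<omega> \<partial>R) = (\<integral>\<omega>. f (U \<omega>) * ?g (U \<omega>) \<partial>R)"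
    if f [measurable]: "f \<in> borel_measurable N" and f_bd: "\<And>x. \<bar>f x\<bar> \<le> 1" for f
  proof -
    have fg_bd: "\<bar>f x * ?g x\<bar> \<le> 1" for x
      using mult_mono[OF f_bd[of x] g_bd[of x]] by (simp add: abs_mult)
    have int_R: "integrable R (\<lambda>\<omega>. indicator (?C k) \<omega> * h (U \<omega>))"
      if "h \<in> borel_measurable N" "\<And>x. \<bar>h x\<bar> \<le> 1" for k and h :: "'b \<Rightarrow> real"
      using that by (intro integrable_const_bound[of _ 1]) (auto split: split_indicator)
    have to_neg: "(\<integral>x. h x \<partial>\<nu> 1) = (\<integral>x. exp (L x) * h x \<partial>\<nu> (-1))"
        "integrable (\<nu> (-1)) (\<lambda>x. exp (L x) * h x)"
      if [measurable]: "h \<in> borel_measurable N" and "\<And>x. \<bar>h x\<bar> \<le> 1" for h :: "'b \<Rightarrow> real"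
    proof -
      show "(\<integral>x. h x \<partial>\<nu> 1) = (\<integral>x. exp (L x) * h x \<partial>\<nu> (-1))"
        unfolding ratio by (subst integral_density) auto
      have "integrable (\<nu> 1) h" using that by (intro int_\<nu>) auto
      thus "integrable (\<nu> (-1)) (\<lambda>x. exp (L x) * h x)"
        unfolding ratio by (subst (asm) integrable_density) auto
    qed
    have "(\<integral>\<omega>. f (U \<omega>) * Y \<omega> \<partial>R) =
        (\<integral>\<omega>. indicator (?C 1) \<omega> * f (U \<omega>) - indicator (?C (-1)) \<omega> * f (U \<omega>) \<partial>R)"
      using Y_vals by (intro Bochner_Integration.integral_cong) (auto split: split_indicator)
    also have "\<dots> = (\<integral>x. f x \<partial>\<nu> 1) / 2 - (\<integral>x. f x \<partial>\<nu> (-1)) / 2"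
      using f_bd by (subst Bochner_Integration.integral_diff) (simp_all add: int_R class_part)
    also have "\<dots> = (\<integral>x. exp (L x) * f x - f x \<partial>\<nu> (-1)) / 2"
      using f_bd by (subst Bochner_Integration.integral_diff) (auto simp: to_neg int_\<nu> diff_divide_distrib)
    also have "(\<lambda>x. exp (L x) * f x - f x) = (\<lambda>x. exp (L x) * (f x * ?g x) + f x * ?g x)"
    proof
      fix x
      have "exp (L x) + 1 \<noteq> 0" by (smt (verit) exp_gt_zero)
      thus "exp (L x) * f x - f x = exp (L x) * (f x * ?g x) + f x * ?g x"
        by (simp add: divide_simps) (simp add: algebra_simps)
    qed
    also have "(\<integral>x. exp (L x) * (f x * ?g x) + f x * ?g x \<partial>\<nu> (-1)) / 2 =
        (\<integral>x. f x * ?g x \<partial>\<nu> 1) / 2 + (\<integral>x. f x * ?g x \<partial>\<nu> (-1)) / 2"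
      by (subst Bochner_Integration.integral_add[OF to_neg(2) int_\<nu>])
         (use fg_bd in \<open>auto simp: to_neg(1) add_divide_distrib\<close>)
    also have "\<dots> = (\<integral>\<omega>. indicator (?C 1) \<omega> * (f (U \<omega>) * ?g (U \<omega>)) +
        indicator (?C (-1)) \<omega> * (f (U \<omega>) * ?g (U \<omega>)) \<partial>R)"
      by (subst Bochner_Integration.integral_add[OF int_R int_R])
         (use fg_bd in \<open>simp_all add: class_part[of _ "\<lambda>x. f x * ?g x"] del: times_divide_eq_right\<close>)
    also have "\<dots> = (\<integral>\<omega>. f (U \<omega>) * ?g (U \<omega>) \<partial>R)"
      using Y_vals by (intro Bochner_Integration.integral_cong) (auto split: split_indicator)
    finally show ?thesis .
  qed
  let ?F = "vimage_algebra (space R) U N"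
  have U_space: "U \<in> space R \<rightarrow> space N" using measurable_space[OF U] by auto
  have U_F [measurable]: "U \<in> measurable ?F N" using U_space by (rule measurable_vimage_algebra1)
  have sub: "subalgebra R ?F"
    unfolding subalgebra_def using U_space by (auto simp: sets_vimage_algebra2)
  interpret F: finite_measure_subalgebra R ?F
    by unfold_locales (rule sub)
  have "AE \<omega> in R. real_cond_exp R ?F Y \<omega> = ?g (U \<omega>)"
  proof (rule F.real_cond_exp_charact)
    fix A assume "A \<in> sets ?F"
    then obtain B where [measurable]: "B \<in> sets N" and A: "A = U -` B \<inter> space R"
      using U_space by (auto simp: sets_vimage_algebra2)
    have "(\<integral>\<omega>. indicator B (U \<omega>) * Y \<omega> \<partial>R) = (\<integral>\<omega>. indicator B (U \<omega>) * ?g (U \<omega>) \<partial>R)"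
      by (rule char) (auto split: split_indicator)
    moreover have "(\<integral>\<omega>\<in>A. h \<omega> \<partial>R) = (\<integral>\<omega>. indicator B (U \<omega>) * h \<omega> \<partial>R)" for h :: "'a \<Rightarrow> real"
      unfolding set_lebesgue_integral_def A
      by (intro Bochner_Integration.integral_cong) (auto split: split_indicator)
    ultimately show "(\<integral>\<omega>\<in>A. Y \<omega> \<partial>R) = (\<integral>\<omega>\<in>A. ?g (U \<omega>) \<partial>R)" by simp
  next
    show "integrable R Y"
      using Y_vals by (intro integrable_const_bound[of _ 1] AE_I2) (force, simp)
    show "integrable R (\<lambda>\<omega>. ?g (U \<omega>))"
      using g_bd by (intro integrable_const_bound[of _ 1] AE_I2) (auto simp del: abs_divide)
    show "(\<lambda>\<omega>. ?g (U \<omega>)) \<in> borel_measurable ?F" by measurable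
  qed
  thus ?thesis unfolding regression_function_def by auto
qed

lemma sign_pm_posterior_mean: "sign_pm ((exp t - 1) / (exp t + 1)) = sign_pm t"
  using exp_gt_zero[of t] by (simp add: sign_pm_def zero_le_divide_iff del: exp_gt_zero)

section \<open>Principal submatrices of positive definite matrices\<close>

lemma invertible_if_positive_definite:
  fixes S :: "real ^ 'd ^ 'd"
  assumes "\<And>v. v \<noteq> 0 \<Longrightarrow> v \<bullet> (S *v v) > 0"
  shows "invertible S"
  unfolding invertible_left_inverse matrix_left_invertible_ker
  by (metis assms inner_zero_right less_irrefl)

text \<open>
  The choice in \<^const>\<open>inverse_on\<close> is meaningful because a principal submatrix of a positive definite
  matrix is invertible. Padding the submatrix with an identity block turns this into invertibility of
  a full square matrix: a kernel vector of the padded matrix vanishes outside \<^term>\<open>I\<close>, hence is a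
  null vector of the quadratic form of \<^term>\<open>S\<close>.
\<close>

lemma inverse_on_positive_definite:
  fixes S :: "real ^ 'd ^ 'd" and I :: "'d set"
  assumes pd: "\<And>v. v \<noteq> 0 \<Longrightarrow> v \<bullet> (S *v v) > 0"
    and A: "\<And>i j. i \<in> I \<Longrightarrow> j \<in> I \<Longrightarrow> A i j = S $ i $ j"
    and "i \<in> I" "j \<in> I"
  shows "(\<Sum>k\<in>I. inverse_on I A i k * A k j) = (if i = j then 1 else 0)"
proof -
  define T :: "real ^ 'd ^ 'd"
    where "T = (\<chi> i j. if i \<in> I \<and> j \<in> I then S $ i $ j else if i = j then 1 else 0)"
  have "v = 0" if Tv: "T *v v = 0" for v
  proof (rule ccontr)
    assume "v \<noteq> 0"
    have off: "v $ j = 0" if "j \<notin> I" for j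
    proof -
      have "(T *v v) $ j = (\<Sum>k\<in>UNIV. if k = j then v $ k else 0)"
        unfolding matrix_vector_mult_def T_def vec_lambda_beta using that
        by (intro sum.cong) auto
      thus ?thesis using Tv by simp
    qed
    have on: "(S *v v) $ j = 0" if "j \<in> I" for j
    proof -
      have "(T *v v) $ j = (S *v v) $ j"
        unfolding matrix_vector_mult_def T_def vec_lambda_beta using that off
        by (intro sum.cong) auto
      thus ?thesis using Tv by simp
    qed
    have "v \<bullet> (S *v v) = 0"
      unfolding inner_vec_def using on off by (intro sum.neutral) (metis inner_real_def mult_zero_left mult_zero_right)
    with pd[OF \<open>v \<noteq> 0\<close>] show False by simp
  qed
  then obtain B where B: "B ** T = mat 1"
    using matrix_left_invertible_ker[of T] by blast
  hence B': "T ** B = mat 1" by (simp add: matrix_left_right_inverse)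
  have "(\<Sum>k\<in>I. A i k * B $ k $ j) = (if i = j then 1 else 0)"
    and "(\<Sum>k\<in>I. B $ i $ k * A k j) = (if i = j then 1 else 0)"
    if ij: "i \<in> I" "j \<in> I" for i j
  proof -
    have "(\<Sum>k\<in>I. A i k * B $ k $ j) = (\<Sum>k\<in>UNIV. T $ i $ k * B $ k $ j)"
      using ij by (intro sum.mono_neutral_cong_left) (auto simp: T_def A)
    also have "\<dots> = (T ** B) $ i $ j" by (simp add: matrix_matrix_mult_def)
    finally show "(\<Sum>k\<in>I. A i k * B $ k $ j) = (if i = j then 1 else 0)"
      by (simp add: B' mat_def)
    have "(\<Sum>k\<in>I. B $ i $ k * A k j) = (\<Sum>k\<in>UNIV. B $ i $ k * T $ k $ j)"
      using ij by (intro sum.mono_neutral_cong_left) (auto simp: T_def A)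
    also have "\<dots> = (B ** T) $ i $ j" by (simp add: matrix_matrix_mult_def)
    finally show "(\<Sum>k\<in>I. B $ i $ k * A k j) = (if i = j then 1 else 0)"
      by (simp add: B mat_def)
  qed
  hence "\<exists>B. \<forall>i\<in>I. \<forall>j\<in>I. (\<Sum>k\<in>I. A i k * B k j) = (if i = j then 1 else 0) \<and>
      (\<Sum>k\<in>I. B i k * A k j) = (if i = j then 1 else 0)"
    by (intro exI[of _ "\<lambda>i j. B $ i $ j"]) blast
  from someI_ex[OF this] show ?thesis
    unfolding inverse_on_def using assms(3,4) by blast
qed

section \<open>Likelihood ratios of normal laws\<close>

lemma measurable_matrix_vector_mult [measurable (raw)]:
  fixes A :: "real ^ 'n ^ 'm"
  assumes "f \<in> borel_measurable M"
  shows "(\<lambda>x. A *v f x) \<in> borel_measurable M"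
  using assms by (rule measurable_compose)
    (intro borel_measurable_continuous_onI matrix_vector_mult_linear_continuous_on)

lemma multivariate_normal_translate:
  "multivariate_normal (\<mu> + t) S = distr (multivariate_normal \<mu> S) borel ((+) t)"
proof -
  let ?f = "\<lambda>\<mu> x. ennreal
     (exp (- ((x - \<mu>) \<bullet> (matrix_inv S *v (x - \<mu>))) / 2) / sqrt ((2 * pi) ^ CARD('a) * det S))"
  have "multivariate_normal (\<mu> + t) S = density (distr lborel borel ((+) t)) (?f (\<mu> + t))"
    unfolding multivariate_normal_def lborel_distr_plus ..
  also have "\<dots> = distr (density lborel (\<lambda>x. ?f (\<mu> + t) (t + x))) borel ((+) t)"
    by (subst density_distr) simp_all
  also have "(\<lambda>x. ?f (\<mu> + t) (t + x)) = ?f \<mu>" by (simp add: algebra_simps)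
  finally show ?thesis unfolding multivariate_normal_def .
qed

text \<open>
  Writing the shift of the mean as \<^term>\<open>S *v v\<close> cancels the inverse of \<^term>\<open>S\<close> in the cross
  term of the exponent, so that the density depends only on those coordinates of \<^term>\<open>x\<close> that
  belong to the support of \<^term>\<open>v\<close>.
\<close>

lemma multivariate_normal_tilt:
  fixes S :: "real ^ 'd ^ 'd"
  assumes inv: "invertible S" and sym: "transpose S = S"
  shows "multivariate_normal (\<mu> + S *v v) S =
    density (multivariate_normal \<mu> S) (\<lambda>x. ennreal (exp (v \<bullet> (x - \<mu>) - v \<bullet> (S *v v) / 2)))"
proof -
  let ?A = "matrix_inv S"
  have A: "?A ** S = mat 1" "S ** ?A = mat 1"
    using someI_ex[OF inv[unfolded invertible_def]] by (auto simp: matrix_inv_def)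
  have AS: "?A *v (S *v w) = w" "S *v (?A *v w) = w" for w
    by (simp_all add: A matrix_vector_mul_assoc)
  have swap: "(S *v u) \<bullet> w = u \<bullet> (S *v w)" for u w
    using dot_lmul_matrix[of u S w] transpose_matrix_vector[of S u] sym by simp
  have quad: "- ((x - (\<mu> + S *v v)) \<bullet> (?A *v (x - (\<mu> + S *v v)))) / 2 =
     - ((x - \<mu>) \<bullet> (?A *v (x - \<mu>))) / 2 + (v \<bullet> (x - \<mu>) - v \<bullet> (S *v v) / 2)" for x
  proof -
    define y where "y = x - \<mu>"
    have "(y - S *v v) \<bullet> (?A *v (y - S *v v)) =
        y \<bullet> (?A *v y) - 2 * (v \<bullet> y) + v \<bullet> (S *v v)"
      by (simp add: matrix_vector_mult_diff_distrib inner_diff_left inner_diff_right AS swap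
          inner_commute[of y v])
    thus ?thesis by (simp add: y_def diff_diff_eq field_simps)
  qed
  let ?c = "sqrt ((2 * pi) ^ CARD('d) * det S)"
  have tilt: "ennreal (exp (- ((x - (\<mu> + S *v v)) \<bullet> (?A *v (x - (\<mu> + S *v v)))) / 2) / ?c) =
      ennreal (exp (- ((x - \<mu>) \<bullet> (?A *v (x - \<mu>))) / 2) / ?c) *
      ennreal (exp (v \<bullet> (x - \<mu>) - v \<bullet> (S *v v) / 2))" for x
    unfolding quad exp_add times_divide_eq_left[symmetric]
    by (subst ennreal_mult''[symmetric]) simp_all
  show ?thesis
    unfolding multivariate_normal_def tilt by (subst density_density_eq) measurable
qed

definition lda_score ::
    "real ^ 'd \<Rightarrow> real ^ 'd \<Rightarrow> real ^ 'd ^ 'd \<Rightarrow> bool ^ 'd \<Rightarrow> ('d \<Rightarrow> real) \<Rightarrow> real" where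
  "lda_score a b S m x =
     (\<Sum>i\<in>obs m. (subvec m a i - subvec m b i) *
        (\<Sum>j\<in>obs m. inverse_on (obs m) (submat m S) i j * (x j - (subvec m a j + subvec m b j) / 2)))"

lemma measurable_lda_score [measurable]: "lda_score a b S m \<in> borel_measurable (obs_space m)"
  unfolding lda_score_def[abs_def] obs_space_def by measurable

lemma measurable_subvec [measurable]: "subvec m \<in> measurable borel (obs_space m)"
  unfolding subvec_def[abs_def] obs_space_def by measurable

text \<open>
  The score enters here as a log-likelihood ratio, whereas \<^const>\<open>lda_rule\<close> keeps only its sign. The
  mean \<^term>\<open>a\<close> is reached from \<^term>\<open>b\<close> in two moves: an exponential tilt by a vector supported on the
  observed coordinates, then a translation that is invisible there.
\<close>

lemma observed_normal_likelihood_ratio: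
  fixes S :: "real ^ 'd ^ 'd"
  assumes sym: "transpose S = S" and pd: "\<And>v. v \<noteq> 0 \<Longrightarrow> v \<bullet> (S *v v) > 0"
  shows "distr (multivariate_normal a S) (obs_space m) (subvec m) =
    density (distr (multivariate_normal b S) (obs_space m) (subvec m))
      (\<lambda>x. ennreal (exp (lda_score a b S m x)))"
proof -
  let ?O = "obs m" and ?B = "inverse_on (obs m) (submat m S)"
  \<comment> \<open>On the observed coordinates \<open>v\<close> is the row vector \<open>(a - b)\<^sup>T B\<close>. Together with the symmetry of
    \<open>S\<close>, the left inverse property of \<open>B\<close> then yields \<open>S v = a - b\<close> there.\<close>
  define v :: "real ^ 'd"
    where "v = (\<chi> j. if j \<in> ?O then \<Sum>i\<in>?O. (a $ i - b $ i) * ?B i j else 0)"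
  have S_sym: "S $ i $ j = S $ j $ i" for i j
    using arg_cong[OF sym, of "\<lambda>A. A $ j $ i"] by (simp add: transpose_def)
  have inner_v: "v \<bullet> x = (\<Sum>j\<in>?O. v $ j * x $ j)" for x
    unfolding inner_vec_def inner_real_def
    by (intro sum.mono_neutral_right) (auto simp: v_def)
  have Sv: "(S *v v) $ j = a $ j - b $ j" if "j \<in> ?O" for j
  proof -
    have "(S *v v) $ j = (\<Sum>k\<in>?O. S $ j $ k * v $ k)"
      unfolding matrix_vector_mult_def vec_lambda_beta
      by (intro sum.mono_neutral_right) (auto simp: v_def)
    also have "\<dots> = (\<Sum>k\<in>?O. \<Sum>i\<in>?O. (a $ i - b $ i) * (?B i k * submat m S k j))"
      using that by (intro sum.cong) (auto simp: v_def submat_def S_sym[of j] sum_distrib_left mult_ac)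
    also have "\<dots> = (\<Sum>i\<in>?O. (a $ i - b $ i) * (\<Sum>k\<in>?O. ?B i k * submat m S k j))"
      unfolding sum_distrib_left by (rule sum.swap)
    also have "\<dots> = (\<Sum>i\<in>?O. (a $ i - b $ i) * (if i = j then 1 else 0))"
      using pd that
      by (intro sum.cong refl arg_cong2[where f = times] inverse_on_positive_definite[of S])
         (auto simp: submat_def)
    also have "\<dots> = a $ j - b $ j"
      using that by (simp add: if_distrib sum.delta cong: if_cong)
    finally show ?thesis .
  qed
  have score: "v \<bullet> (x - b) - v \<bullet> (S *v v) / 2 = lda_score a b S m (subvec m x)" for x
  proof -
    have "v \<bullet> (x - b) - v \<bullet> (S *v v) / 2 =
        (\<Sum>j\<in>?O. v $ j * (x $ j - (a $ j + b $ j) / 2))"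
      unfolding inner_v sum_divide_distrib sum_subtractf[symmetric]
      by (intro sum.cong) (auto simp: Sv field_simps)
    also have "\<dots> = (\<Sum>j\<in>?O. \<Sum>i\<in>?O. (a $ i - b $ i) * (?B i j * (x $ j - (a $ j + b $ j) / 2)))"
      by (intro sum.cong refl) (simp add: v_def sum_distrib_right mult.assoc)
    also have "\<dots> = (\<Sum>i\<in>?O. (a $ i - b $ i) * (\<Sum>j\<in>?O. ?B i j * (x $ j - (a $ j + b $ j) / 2)))"
      unfolding sum_distrib_left by (rule sum.swap)
    also have "\<dots> = lda_score a b S m (subvec m x)"
      unfolding lda_score_def by (intro sum.cong refl) (auto simp: subvec_def)
    finally show ?thesis .
  qed
  have [measurable_cong, simp]: "sets (multivariate_normal \<mu> S) = sets borel" for \<mu>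
    by (simp add: multivariate_normal_def)
  define t where "t = a - (b + S *v v)"
  have "multivariate_normal a S = distr (multivariate_normal (b + S *v v) S) borel ((+) t)"
    by (simp add: t_def flip: multivariate_normal_translate)
  hence "distr (multivariate_normal a S) (obs_space m) (subvec m) =
      distr (multivariate_normal (b + S *v v) S) (obs_space m) (subvec m \<circ> (+) t)"
    by (simp add: distr_distr)
  also have "subvec m \<circ> (+) t = subvec m"
    by (auto simp: fun_eq_iff subvec_def t_def Sv)
  also have "multivariate_normal (b + S *v v) S =
      density (multivariate_normal b S) (\<lambda>x. ennreal (exp (lda_score a b S m (subvec m x))))"
    using multivariate_normal_tilt[OF invertible_if_positive_definite[OF pd] sym]
    by (simp add: score)
  finally show ?thesis
    by (subst density_distr) measurable
qed

section \<open>Conditioning on the missingness pattern\<close>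

lemma distr_cond_event_indep:
  assumes "prob_space P"
    and M: "M \<in> measurable P (count_space UNIV)" and Z: "Z \<in> measurable P N"
    and indep: "prob_space.indep_set P (sets (vimage_algebra (space P) M (count_space UNIV)))
           (sets (vimage_algebra (space P) Z N))"
    and pos: "measure P {\<omega> \<in> space P. M \<omega> = m} > 0"
  shows "distr (uniform_measure P {\<omega> \<in> space P. M \<omega> = m}) N Z = distr P N Z"
proof (rule measure_eqI)
  interpret prob_space P by fact
  note [measurable] = M Z
  let ?E = "{\<omega> \<in> space P. M \<omega> = m}"
  fix B assume "B \<in> sets (distr (uniform_measure P ?E) N Z)"
  hence B [measurable]: "B \<in> sets N" by simp
  have "?E = M -` {m} \<inter> space P" by auto
  hence "?E \<in> sets (vimage_algebra (space P) M (count_space UNIV))"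
    by (simp add: in_vimage_algebra)
  moreover have "Z -` B \<inter> space P \<in> sets (vimage_algebra (space P) Z N)"
    using B by (rule in_vimage_algebra)
  ultimately have "prob (?E \<inter> (Z -` B \<inter> space P)) = prob ?E * prob (Z -` B \<inter> space P)"
    using indep by (intro indep_setD)
  thus "emeasure (distr (uniform_measure P ?E) N Z) B = emeasure (distr P N Z) B"
    using pos by (simp add: emeasure_distr emeasure_eq_measure divide_ennreal)
qed simp

lemma distr_class_conditional_cong:
  assumes [measurable]: "X \<in> measurable P N" "Y \<in> borel_measurable P"
    and R: "sets R = sets P"
    and law: "distr R (N \<Otimes>\<^sub>M borel) (\<lambda>\<omega>. (X \<omega>, Y \<omega>)) = distr P (N \<Otimes>\<^sub>M borel) (\<lambda>\<omega>. (X \<omega>, Y \<omega>))"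
  fixes k :: real
  shows "emeasure R {\<omega> \<in> space R. Y \<omega> = k} = emeasure P {\<omega> \<in> space P. Y \<omega> = k}"
    and "distr (uniform_measure R {\<omega> \<in> space R. Y \<omega> = k}) N X =
      distr (uniform_measure P {\<omega> \<in> space P. Y \<omega> = k}) N X"
proof -
  note [measurable_cong] = R
  have sp: "space R = space P" using R by (rule sets_eq_imp_space_eq)
  have joint: "emeasure R ({\<omega> \<in> space P. Y \<omega> = k} \<inter> (X -` B \<inter> space P)) =
      emeasure P ({\<omega> \<in> space P. Y \<omega> = k} \<inter> (X -` B \<inter> space P))" if [measurable]: "B \<in> sets N" for B
  proof -
    have "emeasure Q ({\<omega> \<in> space P. Y \<omega> = k} \<inter> (X -` B \<inter> space P)) =
        emeasure (distr Q (N \<Otimes>\<^sub>M borel) (\<lambda>\<omega>. (X \<omega>, Y \<omega>))) (B \<times> {k})"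
      if Q [measurable_cong]: "sets Q = sets P" for Q
      using sets_eq_imp_space_eq[OF Q]
      by (subst emeasure_distr) (auto intro!: arg_cong[where f = "emeasure Q"])
    thus ?thesis using law R by simp
  qed
  have [simp]: "{\<omega> \<in> space P. Y \<omega> = k} \<inter> (X -` space N \<inter> space P) = {\<omega> \<in> space P. Y \<omega> = k}"
    using measurable_space[of X P N] by auto
  show mass: "emeasure R {\<omega> \<in> space R. Y \<omega> = k} = emeasure P {\<omega> \<in> space P. Y \<omega> = k}"
    using joint[of "space N"] by (simp add: sp)
  show "distr (uniform_measure R {\<omega> \<in> space R. Y \<omega> = k}) N X =
      distr (uniform_measure P {\<omega> \<in> space P. Y \<omega> = k}) N X"
    using mass joint by (intro measure_eqI) (simp_all add: emeasure_distr sp)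
qed

theorem proposition5p1:
  fixes P :: "'a measure"
    and X :: "'a \<Rightarrow> real ^ 'd"
    and M :: "'a \<Rightarrow> bool ^ 'd"
    and Y :: "'a \<Rightarrow> real"
    and \<mu> :: "real \<Rightarrow> real ^ 'd"
    and S :: "real ^ 'd ^ 'd"
  assumes "prob_space P"
    and "X \<in> borel_measurable P"
    and "M \<in> measurable P (count_space UNIV)"
    and "Y \<in> borel_measurable P"
    and "\<And>\<omega>. \<omega> \<in> space P \<Longrightarrow> Y \<omega> \<in> {-1, 1}"
    and "prob_space.indep_set P
           (sets (vimage_algebra (space P) M (count_space UNIV)))
           (sets (vimage_algebra (space P) (\<lambda>\<omega>. (X \<omega>, Y \<omega>)) (borel \<Otimes>\<^sub>M borel)))"
    and "measure P {\<omega> \<in> space P. Y \<omega> = 1} = measure P {\<omega> \<in> space P. Y \<omega> = -1}"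
    and "transpose S = S"
    and "\<And>v. v \<noteq> 0 \<Longrightarrow> v \<bullet> (S *v v) > 0"
    and "\<And>k. k \<in> {-1, 1} \<Longrightarrow>
           distr (uniform_measure P {\<omega> \<in> space P. Y \<omega> = k}) borel X = multivariate_normal (\<mu> k) S"
  shows "\<forall>m. measure P {\<omega> \<in> space P. M \<omega> = m} > 0 \<longrightarrow>
           pattern_bayes_classifier P X M Y m (lda_rule (\<mu> 1) (\<mu> (-1)) S m) \<and>
           (\<forall>h. pattern_bayes_classifier P X M Y m h \<longrightarrow>
              (AE x in distr (cond_pattern P M m) (obs_space m) (\<lambda>\<omega>. subvec m (X \<omega>)).
                 h x = lda_rule (\<mu> 1) (\<mu> (-1)) S m x))"
proof (intro allI impI)
  fix m :: "bool ^ 'd"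
  assume pos: "measure P {\<omega> \<in> space P. M \<omega> = m} > 0"
  note [measurable] = assms(2-4)
  note vals = assms(5) and sym = assms(8) and pd = assms(9) and normal = assms(10)
  interpret prob_space P by fact
  let ?R = "cond_pattern P M m" and ?N = "obs_space m" and ?U = "\<lambda>\<omega>. subvec m (X \<omega>)"
  let ?L = "lda_score (\<mu> 1) (\<mu> (-1)) S m"
  let ?g = "\<lambda>x. (exp (?L x) - 1) / (exp (?L x) + 1)"
  let ?h = "lda_rule (\<mu> 1) (\<mu> (-1)) S m"
  have sets_R [measurable_cong]: "sets ?R = sets P" by (simp add: cond_pattern_def)
  have sp: "space ?R = space P" using sets_R by (rule sets_eq_imp_space_eq)
  have prob_R: "prob_space ?R"
    unfolding cond_pattern_def using pos
    by (intro prob_space_uniform_measure) (auto simp: emeasure_eq_measure)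
  have law: "distr ?R (borel \<Otimes>\<^sub>M borel) (\<lambda>\<omega>. (X \<omega>, Y \<omega>)) =
      distr P (borel \<Otimes>\<^sub>M borel) (\<lambda>\<omega>. (X \<omega>, Y \<omega>))"
    unfolding cond_pattern_def using pos
    by (intro distr_cond_event_indep assms(1,3,6)) measurable
  note cond_law = distr_class_conditional_cong[OF assms(2,4) sets_R law]
  have U_law: "distr (uniform_measure ?R {\<omega> \<in> space ?R. Y \<omega> = k}) ?N ?U =
      distr (multivariate_normal (\<mu> k) S) ?N (subvec m)" if "k \<in> {-1, 1}" for k
    unfolding normal[OF that, symmetric] cond_law(2)[symmetric]
    by (subst distr_distr) (auto simp: comp_def)
  have reg: "regression_function ?R ?N ?U Y ?g"
  proof (rule regression_function_exp_likelihood_ratio)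
    show "measure ?R {\<omega> \<in> space ?R. Y \<omega> = 1} = measure ?R {\<omega> \<in> space ?R. Y \<omega> = -1}"
      using assms(7) by (simp only: measure_def cond_law(1))
    show "distr (uniform_measure ?R {\<omega> \<in> space ?R. Y \<omega> = 1}) ?N ?U =
        density (distr (uniform_measure ?R {\<omega> \<in> space ?R. Y \<omega> = -1}) ?N ?U) (\<lambda>x. ennreal (exp (?L x)))"
      by (simp add: U_law observed_normal_likelihood_ratio[OF sym pd])
  qed (use prob_R vals sp in auto)
  have sign_g: "?h x = sign_pm (?g x)" for x
    by (simp add: sign_pm_posterior_mean lda_rule_def lda_score_def)
  show "pattern_bayes_classifier P X M Y m ?h \<and>
      (\<forall>h. pattern_bayes_classifier P X M Y m h \<longrightarrow> (AE x in distr ?R ?N ?U. h x = ?h x))"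
  proof (intro conjI allI impI)
    show "pattern_bayes_classifier P X M Y m ?h"
      unfolding pattern_bayes_classifier_def using reg sign_g by blast
    fix h assume "pattern_bayes_classifier P X M Y m h"
    then obtain g' where g': "regression_function ?R ?N ?U Y g'"
      and h: "\<And>x. x \<in> space ?N \<Longrightarrow> h x = sign_pm (g' x)"
      unfolding pattern_bayes_classifier_def by auto
    have [measurable]: "g' \<in> borel_measurable ?N"
      using g' by (simp add: regression_function_def)
    have "AE \<omega> in ?R. g' (?U \<omega>) = ?g (?U \<omega>)"
      using g' reg unfolding regression_function_def by auto
    hence "AE x in distr ?R ?N ?U. g' x = ?g x"
      by (subst AE_distr_iff) auto
    thus "AE x in distr ?R ?N ?U. h x = ?h x"
      using AE_space by eventually_elim (simp add: h sign_g)
  qed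
qed

end
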